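(* Let $k$ be a field of characteristic $0$ and $q$ a prime power. The coalgebras $\mathcal{D}\mathrm{iv}$, $\mathcal{B}\mathrm{in}$ and $\mathcal{B}\mathrm{in}_q$ over $k$ are isomorphic.
   Context: $\mathcal{D}\mathrm{iv}$ (divided powers coalgebra) has basis $\{x_n\mid n\ge0\}$ with $\Delta(x_n)=\sum_{r=0}^n x_r\otimes x_{n-r}$, $\varepsilon(x_n)=\delta_{n,0}$. $\mathcal{B}\mathrm{in}$ (binomial coalgebra) has basis $\{y_n\mid n\ge0\}$ with $\Delta(y_n)=\sum_{r=0}^n\binom{n}{r}y_r\otimes y_{n-r}$, $\varepsilon(y_n)=\delta_{n,0}$. $\mathcal{B}\mathrm{in}_q$ (quantum binomial, or Eulerian, coalgebra) has basis $\{y_n\mid n\ge0\}$ with $\Delta(y_n)=\sum_{r=0}^n{n\brack r}_q\,y_r\otimes y_{n-r}$, $\varepsilon(y_n)=\delta_{n,0}$, where ${n\brack r}_q=\frac{(q^n-1)(q^n-q)\cdots(q^n-q^{r-1})}{(q^r-1)(q^r-q)\cdots(q^r-q^{r-1})}=\frac{[n]_q!}{[r]_q!\,[n-r]_q!}$, $[n]_q=1+q+\cdots+q^{n-1}$ and $[n]_q!=[1]_q[2]_q\cdots[n]_q$. Here $q$ is the cardinality of a finite field. *)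

theory Defs
  imports "HOL-Library.Poly_Mapping" "HOL-Number_Theory.Prime_Powers"
begin

section \<open>Vector spaces with a chosen basis\<close>

text \<open>
  The \<open>'k\<close>-vector space with basis \<open>'b\<close> is the type \<open>'b \<Rightarrow>\<^sub>0 'k\<close> of finitely supported
  functions; the basis vector belonging to \<open>b\<close> is \<open>basis b\<close>.
\<close>

definition smul :: "'k::field \<Rightarrow> ('b \<Rightarrow>\<^sub>0 'k) \<Rightarrow> ('b \<Rightarrow>\<^sub>0 'k)" where
  "smul c p = Poly_Mapping.map ((*) c) p"

definition basis :: "'b \<Rightarrow> ('b \<Rightarrow>\<^sub>0 'k::field)" where
  "basis b = Poly_Mapping.single b 1"

text \<open>Linear extension of a map given on the basis, into a space with scalar multiplication \<open>s\<close>.\<close>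

definition lin_extend ::
  "('k::field \<Rightarrow> 'w \<Rightarrow> 'w) \<Rightarrow> ('b \<Rightarrow> 'w) \<Rightarrow> ('b \<Rightarrow>\<^sub>0 'k) \<Rightarrow> 'w::ab_group_add" where
  "lin_extend s g p = (\<Sum>b\<in>Poly_Mapping.keys p. s (Poly_Mapping.lookup p b) (g b))"

lemma lookup_smul [simp]: "Poly_Mapping.lookup (smul c p) b = c * Poly_Mapping.lookup p b"
  by (simp add: smul_def map.rep_eq when_def)

lemma vector_space_smul: "vector_space (smul :: 'k::field \<Rightarrow> ('b \<Rightarrow>\<^sub>0 'k) \<Rightarrow> _)"
  by unfold_locales
    (auto intro!: poly_mapping_eqI simp: lookup_add algebra_simps)

lemma lin_extend_superset:
  assumes "vector_space s" "finite A" "Poly_Mapping.keys p \<subseteq> A"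
  shows "lin_extend s g p = (\<Sum>b\<in>A. s (Poly_Mapping.lookup p b) (g b))"
proof -
  interpret W: vector_space s by fact
  show ?thesis
    unfolding lin_extend_def
    by (rule sum.mono_neutral_left) (use assms in \<open>auto simp: in_keys_iff\<close>)
qed

lemma linear_lin_extend:
  assumes "vector_space s"
  shows "Vector_Spaces.linear smul s (lin_extend s g)"
proof -
  interpret W: vector_space s by fact
  interpret V: vector_space "smul :: 'a \<Rightarrow> ('c \<Rightarrow>\<^sub>0 'a) \<Rightarrow> _" by (rule vector_space_smul)
  show ?thesis
  proof (unfold_locales, goal_cases)
    case (1 p q)
    let ?A = "Poly_Mapping.keys p \<union> Poly_Mapping.keys q"
    have "lin_extend s g (p + q) = (\<Sum>b\<in>?A. s (Poly_Mapping.lookup (p + q) b) (g b))"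
      by (rule lin_extend_superset) (use assms keys_add[of p q] in auto)
    moreover have "lin_extend s g p = (\<Sum>b\<in>?A. s (Poly_Mapping.lookup p b) (g b))"
      "lin_extend s g q = (\<Sum>b\<in>?A. s (Poly_Mapping.lookup q b) (g b))"
      by (rule lin_extend_superset; use assms in auto)+
    ultimately show ?case
      by (simp add: lookup_add W.scale_left_distrib sum.distrib)
  next
    case (2 c p)
    have "lin_extend s g (smul c p) =
        (\<Sum>b\<in>Poly_Mapping.keys p. s (Poly_Mapping.lookup (smul c p) b) (g b))"
      by (rule lin_extend_superset) (use assms in \<open>auto simp: in_keys_iff\<close>)
    then show ?case
      by (simp add: lin_extend_def W.scale_sum_right)
  qed
qed

lemma lin_extend_basis:
  assumes "vector_space s"
  shows "lin_extend s g (basis b) = g b"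
proof -
  interpret W: vector_space s by fact
  show ?thesis by (simp add: lin_extend_def basis_def)
qed

lemma lin_extend_unique:
  fixes f :: "('b \<Rightarrow>\<^sub>0 'k::field) \<Rightarrow> 'w::ab_group_add"
  assumes "Vector_Spaces.linear smul s f" "\<And>b. f (basis b) = g b"
  shows "f = lin_extend s g"
proof
  fix p :: "'b \<Rightarrow>\<^sub>0 'k"
  interpret f: Vector_Spaces.linear smul s f by fact
  have "p = (\<Sum>b\<in>Poly_Mapping.keys p. smul (Poly_Mapping.lookup p b) (basis b))"
    by (rule poly_mapping_eqI)
      (auto simp: lookup_sum basis_def lookup_single when_def in_keys_iff if_distrib cong: if_cong)
  then have "f p = f (\<Sum>b\<in>Poly_Mapping.keys p. smul (Poly_Mapping.lookup p b) (basis b))"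
    by simp
  then show "f p = lin_extend s g p"
    by (simp add: f.sum f.scale assms(2) lin_extend_def)
qed


section \<open>Tensor products\<close>

text \<open>
  The tensor product of the spaces with bases \<open>'a\<close> and \<open>'b\<close> is the space with basis
  \<open>'a \<times> 'b\<close>, together with the bilinear map \<open>tensor\<close>. The lemmas \<open>bilinear_tensor\<close> and
  \<open>tensor_universal\<close> below say that this is a tensor product.
\<close>

definition tensor :: "('a \<Rightarrow>\<^sub>0 'k::field) \<Rightarrow> ('b \<Rightarrow>\<^sub>0 'k) \<Rightarrow> ('a \<times> 'b \<Rightarrow>\<^sub>0 'k)" where
  "tensor x y = lin_extend smul (\<lambda>a. lin_extend smul (\<lambda>b. basis (a, b)) y) x"

text \<open>The linear map on the tensor product that is induced by a bilinear map \<open>B\<close>.\<close>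

definition tensor_lift ::
  "('k::field \<Rightarrow> 'w \<Rightarrow> 'w) \<Rightarrow> (('a \<Rightarrow>\<^sub>0 'k) \<Rightarrow> ('b \<Rightarrow>\<^sub>0 'k) \<Rightarrow> 'w) \<Rightarrow> ('a \<times> 'b \<Rightarrow>\<^sub>0 'k) \<Rightarrow> 'w::ab_group_add"
  where "tensor_lift s B = lin_extend s (\<lambda>(a, b). B (basis a) (basis b))"

definition bilinear_map ::
  "('k::field \<Rightarrow> 'w \<Rightarrow> 'w) \<Rightarrow> (('a \<Rightarrow>\<^sub>0 'k) \<Rightarrow> ('b \<Rightarrow>\<^sub>0 'k) \<Rightarrow> 'w::ab_group_add) \<Rightarrow> bool" where
  "bilinear_map s B \<longleftrightarrow>
     (\<forall>x. Vector_Spaces.linear smul s (B x)) \<and> (\<forall>y. Vector_Spaces.linear smul s (\<lambda>x. B x y))"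

lemma tensor_basis: "tensor (basis a) (basis b) = basis (a, b)"
  by (simp add: tensor_def lin_extend_basis[OF vector_space_smul])

lemma bilinear_tensor:
  "bilinear_map smul (tensor :: ('a \<Rightarrow>\<^sub>0 'k::field) \<Rightarrow> ('b \<Rightarrow>\<^sub>0 'k) \<Rightarrow> _)"
  unfolding bilinear_map_def
proof (intro conjI allI)
  fix y :: "'b \<Rightarrow>\<^sub>0 'k"
  show "Vector_Spaces.linear smul smul (\<lambda>x :: 'a \<Rightarrow>\<^sub>0 'k. tensor x y)"
    unfolding tensor_def by (rule linear_lin_extend[OF vector_space_smul])
next
  fix x :: "'a \<Rightarrow>\<^sub>0 'k"
  interpret V: vector_space "smul :: 'k \<Rightarrow> ('b \<Rightarrow>\<^sub>0 'k) \<Rightarrow> _" by (rule vector_space_smul)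
  interpret W: vector_space "smul :: 'k \<Rightarrow> ('a \<times> 'b \<Rightarrow>\<^sub>0 'k) \<Rightarrow> _" by (rule vector_space_smul)
  interpret P: vector_space_pair "smul :: 'k \<Rightarrow> ('b \<Rightarrow>\<^sub>0 'k) \<Rightarrow> _"
    "smul :: 'k \<Rightarrow> ('a \<times> 'b \<Rightarrow>\<^sub>0 'k) \<Rightarrow> _" by unfold_locales
  show "Vector_Spaces.linear smul smul (tensor x :: ('b \<Rightarrow>\<^sub>0 'k) \<Rightarrow> _)"
    unfolding tensor_def lin_extend_def[of _ _ x]
    by (intro P.linear_compose_sum ballI P.linear_compose_scale_right
        linear_lin_extend[OF vector_space_smul])
qed

lemma bilinear_map_eqI:
  fixes B C :: "('a \<Rightarrow>\<^sub>0 'k::field) \<Rightarrow> ('b \<Rightarrow>\<^sub>0 'k) \<Rightarrow> 'w::ab_group_add"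
  assumes B: "bilinear_map s B" and C: "bilinear_map s C"
    and eq: "\<And>a b. B (basis a) (basis b) = C (basis a) (basis b)"
  shows "B x y = C x y"
proof -
  have *: "B (basis a) = C (basis a)" for a
    using lin_extend_unique[of s "B (basis a)", OF _ eq]
      lin_extend_unique[of s "C (basis a)", OF _ refl] B C
    by (auto simp: bilinear_map_def)
  have "(\<lambda>x. B x y) = (\<lambda>x. C x y)"
    using lin_extend_unique[of s "\<lambda>x. B x y" "\<lambda>a. C (basis a) y"]
      lin_extend_unique[of s "\<lambda>x. C x y", OF _ refl] B C *
    by (auto simp: bilinear_map_def)
  then show ?thesis by metis
qed

lemma tensor_universal:
  fixes B :: "('a \<Rightarrow>\<^sub>0 'k::field) \<Rightarrow> ('b \<Rightarrow>\<^sub>0 'k) \<Rightarrow> 'w::ab_group_add"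
  assumes s: "vector_space s" and B: "bilinear_map s B"
  shows "Vector_Spaces.linear smul s (tensor_lift s B)"
    and "tensor_lift s B (tensor x y) = B x y"
    and "Vector_Spaces.linear smul s h \<Longrightarrow> (\<And>x y. h (tensor x y) = B x y) \<Longrightarrow> h = tensor_lift s B"
proof -
  show lin: "Vector_Spaces.linear smul s (tensor_lift s B)"
    unfolding tensor_lift_def by (rule linear_lin_extend[OF s])
  have "bilinear_map s (\<lambda>x y. tensor_lift s B (tensor x y))"
    using bilinear_tensor lin unfolding bilinear_map_def
    by (auto intro: Vector_Spaces.linear_compose[unfolded o_def])
  then show "tensor_lift s B (tensor x y) = B x y"
    by (rule bilinear_map_eqI[OF _ B])
      (simp add: tensor_basis tensor_lift_def lin_extend_basis[OF s])
  show "h = tensor_lift s B"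
    if "Vector_Spaces.linear smul s h" "\<And>x y. h (tensor x y) = B x y"
    unfolding tensor_lift_def using that(1)
    by (rule lin_extend_unique) (auto simp flip: that(2) simp: tensor_basis)
qed

definition tensor_map ::
  "(('a \<Rightarrow>\<^sub>0 'k::field) \<Rightarrow> ('c \<Rightarrow>\<^sub>0 'k)) \<Rightarrow> (('b \<Rightarrow>\<^sub>0 'k) \<Rightarrow> ('d \<Rightarrow>\<^sub>0 'k)) \<Rightarrow>
   ('a \<times> 'b \<Rightarrow>\<^sub>0 'k) \<Rightarrow> ('c \<times> 'd \<Rightarrow>\<^sub>0 'k)" where
  "tensor_map f g = tensor_lift smul (\<lambda>x y. tensor (f x) (g y))"

definition tensor_assoc :: "(('a \<times> 'b) \<times> 'c \<Rightarrow>\<^sub>0 'k::field) \<Rightarrow> ('a \<times> 'b \<times> 'c \<Rightarrow>\<^sub>0 'k)" where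
  "tensor_assoc = lin_extend smul (\<lambda>((a, b), c). basis (a, b, c))"


section \<open>Coalgebras\<close>

record (overloaded) ('b, 'k) coalg =
  comult :: "('b \<Rightarrow>\<^sub>0 'k) \<Rightarrow> ('b \<times> 'b \<Rightarrow>\<^sub>0 'k)"
  counit :: "('b \<Rightarrow>\<^sub>0 'k) \<Rightarrow> 'k"

text \<open>
  The two counit axioms use the identifications \<open>k \<otimes> V = V\<close> and \<open>V \<otimes> k = V\<close>: the composites of
  \<open>\<epsilon> \<otimes> id\<close> and \<open>id \<otimes> \<epsilon>\<close> with them are induced by \<open>(x, y) \<mapsto> \<epsilon>(x) y\<close> and \<open>(x, y) \<mapsto> \<epsilon>(y) x\<close>.
\<close>

definition coalgebra :: "('b, 'k::field) coalg \<Rightarrow> bool" where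
  "coalgebra C \<longleftrightarrow>
     Vector_Spaces.linear smul smul (comult C) \<and>
     Vector_Spaces.linear smul (*) (counit C) \<and>
     tensor_assoc \<circ> tensor_map (comult C) id \<circ> comult C = tensor_map id (comult C) \<circ> comult C \<and>
     tensor_lift smul (\<lambda>x y. smul (counit C x) y) \<circ> comult C = id \<and>
     tensor_lift smul (\<lambda>x y. smul (counit C y) x) \<circ> comult C = id"

definition coalgebra_hom ::
  "('a, 'k::field) coalg \<Rightarrow> ('b, 'k) coalg \<Rightarrow> (('a \<Rightarrow>\<^sub>0 'k) \<Rightarrow> ('b \<Rightarrow>\<^sub>0 'k)) \<Rightarrow> bool" where
  "coalgebra_hom C D f \<longleftrightarrow>
     Vector_Spaces.linear smul smul f \<and>
     comult D \<circ> f = tensor_map f f \<circ> comult C \<and>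
     counit D \<circ> f = counit C"

definition coalgebra_isomorphic :: "('a, 'k::field) coalg \<Rightarrow> ('b, 'k) coalg \<Rightarrow> bool" where
  "coalgebra_isomorphic C D \<longleftrightarrow>
     coalgebra C \<and> coalgebra D \<and> (\<exists>f. coalgebra_hom C D f \<and> bij f)"


section \<open>The divided powers, binomial and Eulerian coalgebras\<close>

definition Div :: "(nat, 'k::field) coalg" where
  "Div = \<lparr> comult = lin_extend smul (\<lambda>n. \<Sum>r\<le>n. tensor (basis r) (basis (n - r))),
           counit = lin_extend (*) (\<lambda>n. if n = 0 then 1 else 0) \<rparr>"

definition Bin :: "(nat, 'k::field) coalg" where
  "Bin = \<lparr> comult = lin_extend smul
             (\<lambda>n. \<Sum>r\<le>n. smul (of_nat (n choose r)) (tensor (basis r) (basis (n - r)))),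
           counit = lin_extend (*) (\<lambda>n. if n = 0 then 1 else 0) \<rparr>"

definition q_binomial :: "'k::field \<Rightarrow> nat \<Rightarrow> nat \<Rightarrow> 'k" where
  "q_binomial q n r = (\<Prod>i<r. q ^ n - q ^ i) / (\<Prod>i<r. q ^ r - q ^ i)"

definition Bin_q :: "nat \<Rightarrow> (nat, 'k::field) coalg" where
  "Bin_q q = \<lparr> comult = lin_extend smul
                 (\<lambda>n. \<Sum>r\<le>n. smul (q_binomial (of_nat q) n r) (tensor (basis r) (basis (n - r)))),
               counit = lin_extend (*) (\<lambda>n. if n = 0 then 1 else 0) \<rparr>"

text \<open>The second formula for the Gaussian binomial coefficients, as a check on \<open>q_binomial\<close>.\<close>

definition q_number :: "'k::field \<Rightarrow> nat \<Rightarrow> 'k" where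
  "q_number q n = (\<Sum>i<n. q ^ i)"

definition q_fact :: "'k::field \<Rightarrow> nat \<Rightarrow> 'k" where
  "q_fact q n = (\<Prod>i=1..n. q_number q i)"

lemma q_binomial_eq_q_fact:
  fixes q :: nat
  assumes "q > 1" "r \<le> n"
  shows "q_binomial (of_nat q :: 'k::field_char_0) n r =
           q_fact (of_nat q) n / (q_fact (of_nat q) r * q_fact (of_nat q) (n - r))"
proof -
  let ?q = "of_nat q :: 'k"
  have q: "?q \<noteq> 0" "?q - 1 \<noteq> 0"
    using assms(1) by auto
  have num: "?q ^ m - 1 = (?q - 1) * q_number ?q m" for m
    by (simp add: q_number_def power_diff_1_eq)
  have qn0: "q_number ?q m \<noteq> 0" if "m > 0" for m
  proof -
    have "q ^ m \<noteq> 1" using assms(1) that by simp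
    then have "?q ^ m - 1 \<noteq> 0" by (metis eq_iff_diff_eq_0 of_nat_1 of_nat_eq_iff of_nat_power)
    then show ?thesis using num by auto
  qed
  have fact0: "q_fact ?q m \<noteq> 0" for m
    by (auto simp: q_fact_def qn0)
  have prod: "(\<Prod>i<r. ?q ^ m - ?q ^ i) =
      (\<Prod>i<r. ?q ^ i * (?q - 1)) * (q_fact ?q m / q_fact ?q (m - r))" if "r \<le> m" for m
    using that
  proof (induction r)
    case 0
    then show ?case using fact0 by simp
  next
    case (Suc r)
    have "?q ^ m = ?q ^ r * ?q ^ (m - r)"
      using Suc.prems by (simp flip: power_add)
    then have "?q ^ m - ?q ^ r = ?q ^ r * (?q ^ (m - r) - 1)"
      by (simp add: algebra_simps)
    then have A: "?q ^ m - ?q ^ r = ?q ^ r * (?q - 1) * q_number ?q (m - r)"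
      by (simp only: num mult.assoc)
    have F: "q_fact ?q (m - r) = q_fact ?q (m - Suc r) * q_number ?q (m - r)"
      using Suc.prems by (simp add: q_fact_def flip: Suc_diff_Suc)
    have IH: "(\<Prod>i<r. ?q ^ m - ?q ^ i) =
        (\<Prod>i<r. ?q ^ i * (?q - 1)) * (q_fact ?q m / q_fact ?q (m - r))"
      using Suc by simp
    have "q_number ?q (m - r) \<noteq> 0"
      using Suc.prems by (intro qn0) simp
    then show ?case
      unfolding prod.lessThan_Suc A IH F by simp
  qed
  have "(\<Prod>i<r. ?q ^ i * (?q - 1)) \<noteq> 0"
    using q by simp
  moreover have "q_fact ?q 0 = 1"
    by (simp add: q_fact_def)
  ultimately show ?thesis
    unfolding q_binomial_def prod[OF assms(2)] prod[OF order.refl]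
    by (simp del: prod_zero_iff prod_eq_1_iff add: mult.commute)
qed

end

theory Submission
  imports Defs "HOL-Computational_Algebra.Formal_Power_Series"
begin

text \<open>
  All three comultiplications have the shape
  \<open>\<Delta>(x\<^sub>n) = (\<Sum>r\<le>n. w n / (w r * w (n - r)) x\<^sub>r \<otimes> x\<^sub>n\<^sub>-\<^sub>r)\<close> for a sequence \<open>w\<close> of nonzero scalars
  with \<open>w 0 = 1\<close>: for the divided powers \<open>w\<close> is constantly 1, for the binomial coalgebra it
  is the factorial, and for the Eulerian coalgebra the \<open>q\<close>-factorial. In characteristic 0 the
  factorials and, for \<open>q > 1\<close>, the \<open>q\<close>-factorials do not vanish.

  For such a \<open>w\<close> the elements \<open>x\<^sub>n / w n\<close> comultiply like divided powers, so changing \<open>w\<close>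
  amounts to rescaling the basis: \<open>x\<^sub>n \<mapsto> (v n / w n) x\<^sub>n\<close> is an isomorphism from the coalgebra
  of \<open>v\<close> to that of \<open>w\<close> (\<open>coalgebra_isomorphic_weighted\<close>). The coalgebra axioms hold for all
  these \<open>w\<close> at once (\<open>coalgebra_weighted\<close>): for coassociativity, both
  iterated comultiplications of \<open>x\<^sub>n\<close> equal the sum of
  \<open>w n / (w a * w b * w c) x\<^sub>a \<otimes> x\<^sub>b \<otimes> x\<^sub>c\<close> over \<open>a + b + c = n\<close>.
\<close>

section \<open>Linear maps and tensor products\<close>

lemma linear_eq_on_basis:
  fixes f :: "('b \<Rightarrow>\<^sub>0 'k::field) \<Rightarrow> 'w::ab_group_add"
  assumes "Vector_Spaces.linear smul s f" "Vector_Spaces.linear smul s g"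
    and "\<And>b. f (basis b) = g (basis b)"
  shows "f = g"
  using lin_extend_unique[OF assms(1,3)] lin_extend_unique[OF assms(2) refl] by simp

lemma linear_id_smul: "Vector_Spaces.linear smul smul (id :: ('b \<Rightarrow>\<^sub>0 'k::field) \<Rightarrow> _)"
  by (rule vector_space.linear_id[OF vector_space_smul])

lemma vector_space_field: "vector_space ((*) :: 'k::field \<Rightarrow> 'k \<Rightarrow> 'k)"
  by unfold_locales (auto simp: algebra_simps)

lemma linear_tensor_map: "Vector_Spaces.linear smul smul (tensor_map f g)"
  unfolding tensor_map_def tensor_lift_def by (rule linear_lin_extend[OF vector_space_smul])

lemma tensor_map_basis: "tensor_map f g (basis (a, b)) = tensor (f (basis a)) (g (basis b))"
  by (simp add: tensor_map_def tensor_lift_def lin_extend_basis[OF vector_space_smul])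

lemma smul_smul: "smul a (smul b x) = smul (a * b) x"
  by (simp add: poly_mapping_eqI mult.assoc)

lemma smul_one: "smul 1 x = x"
  by (simp add: poly_mapping_eqI)

lemma linear_scale:
  assumes "Vector_Spaces.linear s t f"
  shows "f (s c x) = t c (f x)"
proof -
  interpret Vector_Spaces.linear s t f by fact
  show ?thesis by (rule scale)
qed

lemma linear_sum:
  assumes "Vector_Spaces.linear s t f"
  shows "f (\<Sum>i\<in>A. g i) = (\<Sum>i\<in>A. f (g i))"
proof -
  interpret Vector_Spaces.linear s t f by fact
  show ?thesis by (rule sum)
qed

lemma linear_tensor_left: "Vector_Spaces.linear smul smul (\<lambda>x. tensor x y)"
  and linear_tensor_right: "Vector_Spaces.linear smul smul (tensor x)"
  using bilinear_tensor unfolding bilinear_map_def by blast+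

lemmas tensor_sum_left = linear_sum[OF linear_tensor_left]
lemmas tensor_sum_right = linear_sum[OF linear_tensor_right]

lemma tensor_smul: "tensor (smul c x) (smul d y) = smul (c * d) (tensor x y)"
  by (simp add: linear_scale[OF linear_tensor_left] linear_scale[OF linear_tensor_right] smul_smul
      mult.commute)

lemma smul_sum:
  fixes f :: "'i \<Rightarrow> 'b \<Rightarrow>\<^sub>0 'k::field"
  shows "smul c (\<Sum>i\<in>A. f i) = (\<Sum>i\<in>A. smul c (f i))"
proof -
  interpret vector_space "smul :: 'k \<Rightarrow> ('b \<Rightarrow>\<^sub>0 'k) \<Rightarrow> _" by (rule vector_space_smul)
  show ?thesis by (rule scale_sum_right)
qed

section \<open>Coalgebras with weights\<close>

definition weighted_coalg :: "(nat \<Rightarrow> 'k::field) \<Rightarrow> (nat, 'k) coalg" where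
  "weighted_coalg w = \<lparr>
     comult = lin_extend smul (\<lambda>n. \<Sum>r\<le>n. smul (w n / (w r * w (n - r))) (basis (r, n - r))),
     counit = lin_extend (*) (\<lambda>n. if n = 0 then 1 else 0) \<rparr>"

lemma linear_comult_weighted: "Vector_Spaces.linear smul smul (comult (weighted_coalg w))"
  by (simp add: weighted_coalg_def linear_lin_extend[OF vector_space_smul])

lemma linear_counit_weighted: "Vector_Spaces.linear smul (*) (counit (weighted_coalg w))"
  by (simp add: weighted_coalg_def linear_lin_extend[OF vector_space_field])

lemma comult_weighted_basis:
  "comult (weighted_coalg w) (basis n) =
     (\<Sum>r\<le>n. smul (w n / (w r * w (n - r))) (basis (r, n - r)))"
  by (simp add: weighted_coalg_def lin_extend_basis[OF vector_space_smul])

lemma counit_weighted_basis: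
  "counit (weighted_coalg w) (basis n) = (if n = 0 then 1 else 0)"
  by (simp add: weighted_coalg_def lin_extend_basis[OF vector_space_field])

lemma linear_apply_comult_weighted:
  assumes "Vector_Spaces.linear smul smul h"
  shows "h (comult (weighted_coalg w) (basis n)) =
           (\<Sum>r\<le>n. smul (w n / (w r * w (n - r))) (h (basis (r, n - r))))"
  by (simp add: comult_weighted_basis linear_sum[OF assms] linear_scale[OF assms])

text \<open>
  The weight of the intermediate index cancels in each iterated comultiplication, which leaves
  \<open>w n / (w a * w b * w c)\<close> in front of \<open>x\<^sub>a \<otimes> x\<^sub>b \<otimes> x\<^sub>c\<close>. It remains to enumerate the triples
  \<open>a + b + c = n\<close> by \<open>a + b\<close> or by \<open>a\<close>, which is also what makes the product of power series
  associative.
\<close>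

lemma coassociative_weighted:
  fixes w :: "nat \<Rightarrow> 'k::field"
  assumes nz: "\<And>n. w n \<noteq> 0"
  shows "tensor_assoc \<circ> tensor_map (comult (weighted_coalg w)) id \<circ> comult (weighted_coalg w) =
         tensor_map id (comult (weighted_coalg w)) \<circ> comult (weighted_coalg w)"
    (is "?L = ?R")
proof (rule linear_eq_on_basis)
  let ?C = "weighted_coalg w"
  have assoc: "Vector_Spaces.linear smul smul
      (tensor_assoc :: ((nat \<times> nat) \<times> nat \<Rightarrow>\<^sub>0 'k) \<Rightarrow> _)"
    unfolding tensor_assoc_def by (rule linear_lin_extend[OF vector_space_smul])
  have assoc_map: "Vector_Spaces.linear smul smul
      (tensor_assoc \<circ> tensor_map (comult ?C) (id :: (nat \<Rightarrow>\<^sub>0 'k) \<Rightarrow> _))"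
    by (rule Vector_Spaces.linear_compose[OF linear_tensor_map assoc])
  show "Vector_Spaces.linear smul smul ?L"
    by (rule Vector_Spaces.linear_compose[OF linear_comult_weighted assoc_map])
  show "Vector_Spaces.linear smul smul ?R"
    by (rule Vector_Spaces.linear_compose[OF linear_comult_weighted linear_tensor_map])
  fix n
  define F where "F a b c = smul (w n / (w a * w b * w c)) (basis (a, b, c))" for a b c
  have assoc_basis: "tensor_assoc (basis ((a, b), c)) = (basis (a, b, c) :: _ \<Rightarrow>\<^sub>0 'k)"
    for a b c :: nat
    by (simp add: tensor_assoc_def lin_extend_basis[OF vector_space_smul])
  have "?L (basis n) = (\<Sum>r\<le>n. \<Sum>a\<le>r. F a (r - a) (n - r))"
    using linear_apply_comult_weighted[OF assoc_map, of w n]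
    by (simp add: tensor_map_basis comult_weighted_basis tensor_sum_left
        linear_scale[OF linear_tensor_left] linear_sum[OF assoc] linear_scale[OF assoc]
        tensor_basis assoc_basis smul_sum smul_smul F_def nz mult_ac)
  also have "\<dots> = (\<Sum>r\<le>n. \<Sum>a\<le>n - r. F r a (n - r - a))"
    using fps_mult_assoc_lemma[where f = F and k = n and n = n] by (simp add: atLeast0AtMost)
  also have "\<dots> = ?R (basis n)"
    using linear_apply_comult_weighted[OF linear_tensor_map, of id "comult ?C" w n]
    by (simp add: tensor_map_basis comult_weighted_basis tensor_sum_right
        linear_scale[OF linear_tensor_right] tensor_basis smul_sum smul_smul F_def nz mult_ac)
  finally show "?L (basis n) = ?R (basis n)" .
qed

text \<open>
  The counit keeps only the summand \<open>r = 0\<close> or \<open>r = n\<close>, whose coefficient is 1 because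
  \<open>w 0 = 1\<close>.
\<close>

lemma counital_weighted:
  fixes w :: "nat \<Rightarrow> 'k::field"
  assumes nz: "\<And>n. w n \<noteq> 0" and w0: "w 0 = 1"
  shows "tensor_lift smul (\<lambda>x y. smul (counit (weighted_coalg w) x) y)
           \<circ> comult (weighted_coalg w) = id"
    and "tensor_lift smul (\<lambda>x y. smul (counit (weighted_coalg w) y) x)
           \<circ> comult (weighted_coalg w) = id"
proof -
  let ?l = "\<lambda>x y. smul (counit (weighted_coalg w) x) y"
  let ?r = "\<lambda>x y. smul (counit (weighted_coalg w) y) x"
  have lin: "Vector_Spaces.linear smul smul (tensor_lift smul B)"
    for B :: "(nat \<Rightarrow>\<^sub>0 'k) \<Rightarrow> (nat \<Rightarrow>\<^sub>0 'k) \<Rightarrow> (nat \<Rightarrow>\<^sub>0 'k)"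
    unfolding tensor_lift_def by (rule linear_lin_extend[OF vector_space_smul])
  have lift_basis: "tensor_lift smul B (basis (a, b)) = B (basis a) (basis b)"
    for B :: "(nat \<Rightarrow>\<^sub>0 'k) \<Rightarrow> (nat \<Rightarrow>\<^sub>0 'k) \<Rightarrow> (nat \<Rightarrow>\<^sub>0 'k)" and a b
    by (simp add: tensor_lift_def lin_extend_basis[OF vector_space_smul])
  have delta: "smul c (smul (if P then 1 else 0) x) = (if P then smul c x else 0)"
    for c :: 'k and P and x :: "nat \<Rightarrow>\<^sub>0 'k"
    by (auto intro: poly_mapping_eqI)
  have l: "tensor_lift smul ?l (comult (weighted_coalg w) (basis n)) = basis n" for n
    unfolding linear_apply_comult_weighted[OF lin] lift_basis counit_weighted_basis delta
    by (simp add: nz w0 smul_one)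
  have "tensor_lift smul ?r (comult (weighted_coalg w) (basis n)) =
      (\<Sum>r\<le>n. if r = n then smul (w n / (w r * w (n - r))) (basis r) else 0)" for n
    unfolding linear_apply_comult_weighted[OF lin] lift_basis counit_weighted_basis delta
    by (rule sum.cong) auto
  then have r: "tensor_lift smul ?r (comult (weighted_coalg w) (basis n)) = basis n" for n
    by (simp add: nz w0 smul_one)
  show "tensor_lift smul ?l \<circ> comult (weighted_coalg w) = id"
    by (rule linear_eq_on_basis[OF
          Vector_Spaces.linear_compose[OF linear_comult_weighted lin] linear_id_smul])
      (simp add: l)
  show "tensor_lift smul ?r \<circ> comult (weighted_coalg w) = id"
    by (rule linear_eq_on_basis[OF
          Vector_Spaces.linear_compose[OF linear_comult_weighted lin] linear_id_smul])
      (simp add: r)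
qed

lemma coalgebra_weighted:
  assumes "\<And>n. w n \<noteq> 0" "w 0 = 1"
  shows "coalgebra (weighted_coalg w)"
  using assms unfolding coalgebra_def
  by (intro conjI linear_comult_weighted linear_counit_weighted coassociative_weighted
      counital_weighted)

section \<open>Rescaling the basis\<close>

definition rescale :: "(nat \<Rightarrow> 'k::field) \<Rightarrow> (nat \<Rightarrow>\<^sub>0 'k) \<Rightarrow> (nat \<Rightarrow>\<^sub>0 'k)" where
  "rescale c = lin_extend smul (\<lambda>n. smul (c n) (basis n))"

lemma linear_rescale: "Vector_Spaces.linear smul smul (rescale c)"
  unfolding rescale_def by (rule linear_lin_extend[OF vector_space_smul])

lemma rescale_basis: "rescale c (basis n) = smul (c n) (basis n)"
  by (simp add: rescale_def lin_extend_basis[OF vector_space_smul])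

lemma rescale_inverse:
  assumes "\<And>n. c n * d n = 1"
  shows "rescale c \<circ> rescale d = id"
  by (rule linear_eq_on_basis[OF
        Vector_Spaces.linear_compose[OF linear_rescale linear_rescale] linear_id_smul])
    (use assms in \<open>simp add: rescale_basis linear_scale[OF linear_rescale] smul_smul smul_one
      mult.commute\<close>)

lemma bij_rescale:
  assumes "\<And>n. c n \<noteq> 0"
  shows "bij (rescale c)"
  by (rule o_bij[of "rescale (\<lambda>n. inverse (c n))"]; rule rescale_inverse; simp add: assms)

lemma coalgebra_hom_rescale:
  fixes v w :: "nat \<Rightarrow> 'k::field"
  assumes v: "\<And>n. v n \<noteq> 0" "v 0 = 1" and w: "\<And>n. w n \<noteq> 0" "w 0 = 1"
  shows "coalgebra_hom (weighted_coalg v) (weighted_coalg w) (rescale (\<lambda>n. v n / w n))"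
    (is "coalgebra_hom ?V ?W ?f")
  unfolding coalgebra_hom_def
proof (intro conjI)
  show "Vector_Spaces.linear smul smul ?f" by (rule linear_rescale)
  show "comult ?W \<circ> ?f = tensor_map ?f ?f \<circ> comult ?V"
  proof (rule linear_eq_on_basis)
    show "Vector_Spaces.linear smul smul (comult ?W \<circ> ?f)"
      by (rule Vector_Spaces.linear_compose[OF linear_rescale linear_comult_weighted])
    show "Vector_Spaces.linear smul smul (tensor_map ?f ?f \<circ> comult ?V)"
      by (rule Vector_Spaces.linear_compose[OF linear_comult_weighted linear_tensor_map])
    fix n
    \<comment> \<open>Both sides have the coefficient \<open>v n / (w r * w (n - r))\<close> at \<open>(r, n - r)\<close>.\<close>
    show "(comult ?W \<circ> ?f) (basis n) = (tensor_map ?f ?f \<circ> comult ?V) (basis n)"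
      by (simp add: linear_sum[OF linear_tensor_map] linear_scale[OF linear_tensor_map]
          tensor_map_basis
          rescale_basis linear_scale[OF linear_comult_weighted] comult_weighted_basis
          tensor_smul tensor_basis smul_sum smul_smul v w)
  qed
  show "counit ?W \<circ> ?f = counit ?V"
    by (rule linear_eq_on_basis[OF
          Vector_Spaces.linear_compose[OF linear_rescale linear_counit_weighted]
          linear_counit_weighted])
      (simp add: rescale_basis linear_scale[OF linear_counit_weighted] counit_weighted_basis v w)
qed

lemma coalgebra_isomorphic_weighted:
  fixes v w :: "nat \<Rightarrow> 'k::field"
  assumes "\<And>n. v n \<noteq> 0" "v 0 = 1" "\<And>n. w n \<noteq> 0" "w 0 = 1"
  shows "coalgebra_isomorphic (weighted_coalg v) (weighted_coalg w)"
  unfolding coalgebra_isomorphic_def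
  using coalgebra_hom_rescale[of v w] bij_rescale[of "\<lambda>n. v n / w n"]
    coalgebra_weighted[of v] coalgebra_weighted[of w] assms
  by auto

section \<open>Factorials and \<open>q\<close>-factorials as weights\<close>

text \<open>
  A \<open>q\<close>-number of positive index is the image of a positive integer, its first summand being \<open>q ^ 0 = 1\<close>, and so
  it is nonzero in characteristic 0.
\<close>

lemma q_fact_nonzero:
  fixes q :: nat
  assumes "q > 0"
  shows "q_fact (of_nat q :: 'k::field_char_0) n \<noteq> 0"
proof -
  have "(\<Sum>i<m. q ^ i) \<noteq> 0" if "m > 0" for m
    using assms that by auto
  then have "q_number (of_nat q :: 'k) m \<noteq> 0" if "m > 0" for m
    using that unfolding q_number_def of_nat_power[symmetric] of_nat_sum[symmetric] of_nat_eq_0_iff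
    by blast
  then show ?thesis by (simp add: q_fact_def)
qed

lemma Div_eq_weighted: "Div = weighted_coalg (\<lambda>_. 1)"
  by (simp add: Div_def weighted_coalg_def tensor_basis smul_one)

lemma Bin_eq_weighted: "(Bin :: (nat, 'k::field_char_0) coalg) = weighted_coalg fact"
  by (simp add: Bin_def weighted_coalg_def tensor_basis binomial_fact cong: sum.cong_simp)

lemma Bin_q_eq_weighted:
  assumes "q > 1"
  shows "(Bin_q q :: (nat, 'k::field_char_0) coalg) = weighted_coalg (q_fact (of_nat q))"
  using assms
  by (simp add: Bin_q_def weighted_coalg_def tensor_basis q_binomial_eq_q_fact cong: sum.cong_simp)

theorem proposition3p2:
  fixes q :: nat
  assumes "primepow q"
  shows "coalgebra_isomorphic (Div :: (nat, 'k::field_char_0) coalg) (Bin :: (nat, 'k) coalg) \<and>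
         coalgebra_isomorphic (Div :: (nat, 'k) coalg) (Bin_q q :: (nat, 'k) coalg) \<and>
         coalgebra_isomorphic (Bin :: (nat, 'k) coalg) (Bin_q q :: (nat, 'k) coalg)"
proof -
  have q: "q > 1" using assms by (simp add: primepow_gt_Suc_0)
  have "q_fact (of_nat q :: 'k) 0 = 1" by (simp add: q_fact_def)
  then show ?thesis
    unfolding Div_eq_weighted Bin_eq_weighted Bin_q_eq_weighted[OF q] using q
    by (intro conjI coalgebra_isomorphic_weighted) (simp_all add: q_fact_nonzero)
qed

end
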